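(* Assume Axiom 1* (stated in the context). Let $N\in\mathbb{N}$ and suppose the resultant force on the particle over the time interval $[0,N\tau]$ equals zero. Then the following hold. 1) The particle moves with constant velocity during the time interval $[0,N\tau]$, that is, the velocity $\mathbf{v}=\mathbf{v}(n)$ is the same for all $n\leqslant N$. 2) For any $n\leqslant N$: $E(\mathbf{R}_n)=n\tau\mathbf{v}$. 3) Suppose $N\to\infty$ in such a way that $N\tau=C$ for a constant $C>0$ (so the time interval $[0,N\tau]=[0,C]$ is fixed; i.e. for each $N\ge 1$ one takes $\tau=C/N$ and $\varepsilon=c\tau=cC/N$ with $c$ fixed, and the resultant force over $[0,N\tau]$ is zero). Then $Tr(\mathbf{R}_N)\to 0$.
   Context: $\mathbb{N}$ includes $0$; $\mathbb{N}_7=\{0,1,\dots,6\}$; $\Omega=(\mathbb{N}_7)^{\mathbb{N}}$, with elements $\omega=(\omega_0,\omega_1,\dots)$. For each $n\in\mathbb{N}$, fixed non-negative numbers $p_n(i)$, $i\in\mathbb{N}_7$, satisfy $\sum_{i=0}^6 p_n(i)=1$. $\mathcal{F}$ is the $\sigma$-algebra on $\Omega$ generated by the sets $C(n,i)=\{\omega\in\Omega:\omega_n=i\}$, and $P$ is the probability measure on $\mathcal{F}$ satisfying $P\big(C(0,i_0)\cap C(1,i_1)\cap\dots\cap C(n,i_n)\big)=\prod_{k=0}^n p_k(i_k)$ for all $n\in\mathbb{N}$ and $i_0,\dots,i_n\in\mathbb{N}_7$, and $P(C(n,i))=p_n(i)$. Parameters: $\tau>0$ (unit of time), $c>0$ is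 fixed, $\varepsilon=c\tau$. With $\mathbf{e}_1,\mathbf{e}_2,\mathbf{e}_3$ the standard basis of $\mathbb{R}^3$, set $\mathbf{s}(0)=(0,0,0)$, and $\mathbf{s}(i)=\varepsilon\mathbf{e}_i$, $\mathbf{s}(i+3)=-\varepsilon\mathbf{e}_i$ for $i=1,2,3$. Random walk: $\mathbf{S}_n(\omega)=\mathbf{s}(\omega_n)$ for $n\in\mathbb{N}$; $\mathbf{R}_0=(0,0,0)$ and $\mathbf{R}_n=\mathbf{S}_0+\dots+\mathbf{S}_{n-1}$ for $n\ge1$. $\mathbf{R}_n$ is the position of the particle at time $n\tau$. The velocity at time $n\tau$ is $\mathbf{v}(n)=E(\mathbf{S}_n)/\tau$. For a random vector $\boldsymbol{X}=(X_1,X_2,X_3)$, $Tr(\boldsymbol{X})=Var(X_1)+Var(X_2)+Var(X_3)$. Force: "the resultant force on the particle during the time interval $[n\tau,(n+1)\tau]$ equals zero" is a primitive condition on $n$, and the resultant force over $[0,N\tau]$ being zero means that this condition holds for every $n$ with $0\le n<N$. The only thing assumed about it is the following. Axiom 1*: For any $n\in\mathbb{N}$, if the resultant force on the particle during the time interval $[n\tau,(n+1)\tau]$ equals zero, then $p_{n+1}(i)-p_{n+1}(i+3)=p_n(i)-p_n(i+3)$ for each $i\in\{1,2,3\}$. *)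

theory Defs
  imports "HOL-Probability.Probability"
begin

definition N7 :: "nat set" where
  "N7 = {0..6}"

definition Omega :: "(nat \<Rightarrow> nat) set" where
  "Omega = {\<omega>. \<forall>n. \<omega> n \<in> N7}"

definition cyl :: "nat \<Rightarrow> nat \<Rightarrow> (nat \<Rightarrow> nat) set" where
  "cyl n i = {\<omega> \<in> Omega. \<omega> n = i}"

locale walk_space = prob_space P
  for P :: "(nat \<Rightarrow> nat) measure" +
  fixes p :: "nat \<Rightarrow> nat \<Rightarrow> real"
  assumes p_nonneg: "\<And>n i. i \<in> N7 \<Longrightarrow> 0 \<le> p n i"
    and p_sum: "\<And>n. (\<Sum>i\<in>N7. p n i) = 1"
    and space_P: "space P = Omega"
    and sets_P: "sets P = sigma_sets Omega {cyl n i | n i. i \<in> N7}"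
    and prob_cyls: "\<And>n i. (\<And>k. k \<le> n \<Longrightarrow> i k \<in> N7) \<Longrightarrow>
      measure P (\<Inter>k\<in>{0..n}. cyl k (i k)) = (\<Prod>k=0..n. p k (i k))"
    and prob_cyl: "\<And>n i. i \<in> N7 \<Longrightarrow> measure P (cyl n i) = p n i"

text \<open>
  In the index type 3 the numeral 3 denotes the same element as 0, so \<open>of_nat\<close> maps
  1, 2, 3 bijectively onto the three coordinates. Only arguments in \<open>N7\<close> are meaningful.
\<close>

definition step :: "real \<Rightarrow> nat \<Rightarrow> real ^ 3" where
  "step \<epsilon> i =
    (if i = 0 then 0
     else if i \<le> 3 then \<epsilon> *\<^sub>R axis (of_nat i) 1
     else - (\<epsilon> *\<^sub>R axis (of_nat (i - 3)) 1))"

definition S :: "real \<Rightarrow> nat \<Rightarrow> (nat \<Rightarrow> nat) \<Rightarrow> real ^ 3" where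
  "S \<epsilon> n \<omega> = step \<epsilon> (\<omega> n)"

definition R :: "real \<Rightarrow> nat \<Rightarrow> (nat \<Rightarrow> nat) \<Rightarrow> real ^ 3" where
  "R \<epsilon> n \<omega> = (\<Sum>k<n. S \<epsilon> k \<omega>)"

text \<open>The step length is tied to the time unit by \<open>\<epsilon> = c * \<tau>\<close>.\<close>

definition velocity :: "(nat \<Rightarrow> nat) measure \<Rightarrow> real \<Rightarrow> real \<Rightarrow> nat \<Rightarrow> real ^ 3" where
  "velocity P c \<tau> n = prob_space.expectation P (S (c * \<tau>) n) /\<^sub>R \<tau>"

definition Tr :: "'a measure \<Rightarrow> ('a \<Rightarrow> real ^ 3) \<Rightarrow> real" where
  "Tr P X = (\<Sum>j\<in>UNIV. prob_space.variance P (\<lambda>\<omega>. X \<omega> $ j))"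

text \<open>
  A predicate \<open>Z :: nat \<Rightarrow> bool\<close> represents the primitive condition that the resultant force
  during the \<open>n\<close>-th time interval \<open>[n \<tau>, (n + 1) \<tau>]\<close> equals zero.
\<close>

definition zero_force_upto :: "(nat \<Rightarrow> bool) \<Rightarrow> nat \<Rightarrow> bool" where
  "zero_force_upto Z N \<longleftrightarrow> (\<forall>n<N. Z n)"

definition axiom_1_star :: "(nat \<Rightarrow> nat \<Rightarrow> real) \<Rightarrow> (nat \<Rightarrow> bool) \<Rightarrow> bool" where
  "axiom_1_star p Z \<longleftrightarrow>
    (\<forall>n. Z n \<longrightarrow> (\<forall>i\<in>{1,2,3}. p (Suc n) i - p (Suc n) (i + 3) = p n i - p n (i + 3)))"

end

theory Submission
  imports Defs
begin

text \<open>
  The mean step is \<open>E (S n) = \<epsilon> * (\<Sum>j = 1..3. (p n j - p n (j + 3)) e_j)\<close>, so it depends on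
  \<open>p n\<close> only through the three differences that Axiom 1* preserves across an interval without
  force. This makes the velocity constant, and \<open>E (R n) = n \<tau> v\<close> is then linearity of
  expectation.

  For the last claim, the product formula for the measure makes the coordinates of \<open>\<omega>\<close>
  independent, in particular pairwise uncorrelated. Variances of the components of \<open>R N\<close>
  therefore add up, and each single step, having length at most \<open>\<epsilon>\<close>, contributes at most
  \<open>\<epsilon>\<^sup>2\<close> to the trace (lemma \<open>Tr_R_le\<close>). With \<open>\<epsilon> = c C / N\<close> this gives
  \<open>Tr (R N) \<le> N (c C / N)\<^sup>2 = (c C)\<^sup>2 / N\<close>, which tends to \<open>0\<close>.
\<close>

section \<open>Variance of a sum of uncorrelated variables\<close>

text \<open>
  After centring, the square of the sum expands into products whose mixed terms have mean zero.
\<close>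

lemma (in prob_space) variance_sum_uncorrelated:
  fixes X :: "'b \<Rightarrow> 'a \<Rightarrow> real"
  assumes "finite A"
    and int: "\<And>i. i \<in> A \<Longrightarrow> integrable M (X i)"
    and int2: "\<And>i j. i \<in> A \<Longrightarrow> j \<in> A \<Longrightarrow> integrable M (\<lambda>\<omega>. X i \<omega> * X j \<omega>)"
    and unc: "\<And>i j. i \<in> A \<Longrightarrow> j \<in> A \<Longrightarrow> i \<noteq> j \<Longrightarrow>
      expectation (\<lambda>\<omega>. X i \<omega> * X j \<omega>) = expectation (X i) * expectation (X j)"
  shows "variance (\<lambda>\<omega>. \<Sum>i\<in>A. X i \<omega>) = (\<Sum>i\<in>A. variance (X i))"
proof -
  define Y where "Y i \<omega> = X i \<omega> - expectation (X i)" for i \<omega>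
  have Y_mult: "Y i \<omega> * Y j \<omega> = X i \<omega> * X j \<omega> - expectation (X j) * X i \<omega>
      - expectation (X i) * X j \<omega> + expectation (X i) * expectation (X j)" for i j \<omega>
    by (simp add: Y_def algebra_simps)
  have intY: "integrable M (\<lambda>\<omega>. Y i \<omega> * Y j \<omega>)" if "i \<in> A" "j \<in> A" for i j
    unfolding Y_mult using that by (simp add: int int2)
  have EY: "expectation (\<lambda>\<omega>. Y i \<omega> * Y j \<omega>) = (if i = j then variance (X i) else 0)"
    if "i \<in> A" "j \<in> A" for i j
  proof (cases "i = j")
    case True
    then show ?thesis by (simp add: Y_def power2_eq_square)
  next
    case False
    then show ?thesis
      unfolding Y_mult using that by (simp add: int int2 unc prob_space)
  qed
  have "variance (\<lambda>\<omega>. \<Sum>i\<in>A. X i \<omega>) = expectation (\<lambda>\<omega>. (\<Sum>i\<in>A. Y i \<omega>)\<^sup>2)"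
    by (simp add: int Y_def sum_subtractf)
  also have "\<dots> = expectation (\<lambda>\<omega>. \<Sum>i\<in>A. \<Sum>j\<in>A. Y i \<omega> * Y j \<omega>)"
    by (simp add: power2_eq_square sum_product)
  also have "\<dots> = (\<Sum>i\<in>A. \<Sum>j\<in>A. expectation (\<lambda>\<omega>. Y i \<omega> * Y j \<omega>))"
    by (simp add: intY)
  also have "\<dots> = (\<Sum>i\<in>A. variance (X i))"
    using \<open>finite A\<close> by (simp add: EY)
  finally show ?thesis .
qed

section \<open>Independence of the coordinates\<close>

lemma finite_N7 [simp]: "finite N7"
  by (simp add: N7_def)

lemma N7_eq: "N7 = {0, 1, 2, 3, 4, 5, 6}"
  by (auto simp: N7_def)

lemma norm_step_le: "norm (step \<epsilon> i) \<le> \<bar>\<epsilon>\<bar>"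
  by (simp add: step_def)

context walk_space
begin

lemma cyl_sets: "i \<in> N7 \<Longrightarrow> cyl n i \<in> sets P"
  unfolding sets_P by (rule sigma_sets.Basic) blast

lemma coord_in_N7: "\<omega> \<in> space P \<Longrightarrow> \<omega> n \<in> N7"
  by (simp add: space_P Omega_def)

lemma coord_eq_sum_indicator:
  fixes f :: "nat \<Rightarrow> 'b::real_vector"
  assumes "\<omega> \<in> space P"
  shows "f (\<omega> n) = (\<Sum>i\<in>N7. indicator (cyl n i) \<omega> *\<^sub>R f i)"
proof -
  have "(\<Sum>i\<in>N7. indicator (cyl n i) \<omega> *\<^sub>R f i) = (\<Sum>i\<in>N7. if i = \<omega> n then f i else 0)"
    using assms by (intro sum.cong) (auto simp: cyl_def space_P indicator_def)
  then show ?thesis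
    using coord_in_N7[OF assms] by simp
qed

lemma has_expectation_coord:
  fixes f :: "nat \<Rightarrow> 'b::{banach, second_countable_topology}"
  shows "has_bochner_integral P (\<lambda>\<omega>. f (\<omega> n)) (\<Sum>i\<in>N7. p n i *\<^sub>R f i)"
proof -
  have "has_bochner_integral P (\<lambda>\<omega>. \<Sum>i\<in>N7. indicator (cyl n i) \<omega> *\<^sub>R f i)
      (\<Sum>i\<in>N7. p n i *\<^sub>R f i)"
  proof (intro has_bochner_integral_sum has_bochner_integral_scaleR_left)
    fix i assume i: "i \<in> N7"
    show "has_bochner_integral P (indicator (cyl n i)) (p n i)"
      using has_bochner_integral_real_indicator[OF cyl_sets[OF i, of n]] prob_cyl[OF i, of n]
      by (simp add: emeasure_eq_measure)
  qed
  moreover have "has_bochner_integral P (\<lambda>\<omega>. f (\<omega> n)) x \<longleftrightarrow>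
      has_bochner_integral P (\<lambda>\<omega>. \<Sum>i\<in>N7. indicator (cyl n i) \<omega> *\<^sub>R f i) x" for x
    by (rule has_bochner_integral_cong) (simp_all add: coord_eq_sum_indicator[where f = f])
  ultimately show ?thesis
    by simp
qed

text \<open>
  Expanding each factor into indicators of cylinders turns the left-hand side into a linear
  combination of probabilities of finite intersections of cylinders. The measure of these is a
  product, so the sum over all words of length \<open>n + 1\<close> factorises again.
\<close>

lemma has_expectation_prod_coords:
  fixes f :: "nat \<Rightarrow> nat \<Rightarrow> real"
  shows "has_bochner_integral P (\<lambda>\<omega>. \<Prod>k\<in>{0..n}. f k (\<omega> k))
    (\<Prod>k\<in>{0..n}. \<Sum>i\<in>N7. p k i * f k i)"
proof -
  define W where "W = PiE {0..n} (\<lambda>_. N7)"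
  have expand: "(\<Prod>k\<in>{0..n}. f k (\<omega> k)) =
      (\<Sum>w\<in>W. (\<Prod>k\<in>{0..n}. f k (w k)) * indicator (\<Inter>k\<in>{0..n}. cyl k (w k)) \<omega>)"
    if "\<omega> \<in> space P" for \<omega>
  proof -
    have "(\<Prod>k\<in>{0..n}. f k (\<omega> k)) = (\<Prod>k\<in>{0..n}. \<Sum>i\<in>N7. indicator (cyl k i) \<omega> * f k i)"
      by (intro prod.cong refl) (use coord_eq_sum_indicator[OF that, of "f _"] in simp)
    also have "\<dots> = (\<Sum>w\<in>W. \<Prod>k\<in>{0..n}. indicator (cyl k (w k)) \<omega> * f k (w k))"
      unfolding W_def by (rule prod_sum_PiE) auto
    also have "\<dots> = (\<Sum>w\<in>W. (\<Prod>k\<in>{0..n}. f k (w k)) *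
        indicator (\<Inter>k\<in>{0..n}. cyl k (w k)) \<omega>)"
    proof (intro sum.cong refl)
      fix w
      have "(\<Prod>k\<in>{0..n}. indicator (cyl k (w k)) \<omega> :: real)
          = indicator (\<Inter>k\<in>{0..n}. cyl k (w k)) \<omega>"
        by (auto simp: indicator_def intro: prod.neutral)
      then show "(\<Prod>k\<in>{0..n}. indicator (cyl k (w k)) \<omega> * f k (w k))
          = (\<Prod>k\<in>{0..n}. f k (w k)) * indicator (\<Inter>k\<in>{0..n}. cyl k (w k)) \<omega>"
        by (simp add: prod.distrib)
    qed
    finally show ?thesis .
  qed
  have "has_bochner_integral P
      (\<lambda>\<omega>. \<Sum>w\<in>W. (\<Prod>k\<in>{0..n}. f k (w k)) * indicator (\<Inter>k\<in>{0..n}. cyl k (w k)) \<omega>)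
      (\<Sum>w\<in>W. (\<Prod>k\<in>{0..n}. f k (w k)) * (\<Prod>k\<in>{0..n}. p k (w k)))"
  proof (intro has_bochner_integral_sum has_bochner_integral_mult_right)
    fix w assume "w \<in> W"
    then have w: "w k \<in> N7" if "k \<le> n" for k
      using that by (auto simp: W_def)
    have "(\<Inter>k\<in>{0..n}. cyl k (w k)) \<in> sets P"
      by (intro sets.finite_INT) (auto simp: w intro: cyl_sets)
    from has_bochner_integral_real_indicator[OF this]
    show "has_bochner_integral P (indicator (\<Inter>k\<in>{0..n}. cyl k (w k))) (\<Prod>k\<in>{0..n}. p k (w k))"
      using prob_cyls[of n w] w by (simp add: emeasure_eq_measure)
  qed
  moreover have "(\<Sum>w\<in>W. (\<Prod>k\<in>{0..n}. f k (w k)) * (\<Prod>k\<in>{0..n}. p k (w k)))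
      = (\<Prod>k\<in>{0..n}. \<Sum>i\<in>N7. p k i * f k i)"
    unfolding W_def by (subst prod_sum_PiE) (auto simp: prod.distrib mult.commute)
  moreover have "has_bochner_integral P (\<lambda>\<omega>. \<Prod>k\<in>{0..n}. f k (\<omega> k)) x \<longleftrightarrow>
      has_bochner_integral P
        (\<lambda>\<omega>. \<Sum>w\<in>W. (\<Prod>k\<in>{0..n}. f k (w k)) * indicator (\<Inter>k\<in>{0..n}. cyl k (w k)) \<omega>) x" for x
    by (rule has_bochner_integral_cong[OF refl _ refl]) (rule expand)
  ultimately show ?thesis
    by simp
qed

text \<open>
  This is the product rule for words of length \<open>m + n + 1\<close>, which reach both positions, with the
  factor \<open>1\<close> at every other position. Such a factor has mean \<open>1\<close> because \<open>p k\<close> sums to \<open>1\<close>.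
\<close>

lemma uncorrelated_coords:
  fixes f g :: "nat \<Rightarrow> real"
  assumes "m \<noteq> n"
  shows "expectation (\<lambda>\<omega>. f (\<omega> m) * g (\<omega> n)) =
    expectation (\<lambda>\<omega>. f (\<omega> m)) * expectation (\<lambda>\<omega>. g (\<omega> n))"
proof -
  have prod_two: "(\<Prod>k\<in>{0..m + n}. if k = m then a else if k = n then b else 1) = a * b"
    for a b :: real
  proof -
    have "(\<Prod>k\<in>{0..m + n}. if k = m then a else if k = n then b else 1)
        = (\<Prod>k\<in>{m, n}. if k = m then a else if k = n then b else 1)"
      by (rule prod.mono_neutral_right) auto
    then show ?thesis
      using assms by simp
  qed
  define h where "h k = (if k = m then f else if k = n then g else (\<lambda>_. 1))" for k
  have "(\<Prod>k\<in>{0..m + n}. h k (\<omega> k)) = f (\<omega> m) * g (\<omega> n)" for \<omega>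
    unfolding prod_two[symmetric] by (intro prod.cong) (auto simp: h_def)
  moreover have "(\<Prod>k\<in>{0..m + n}. \<Sum>i\<in>N7. p k i * h k i)
      = (\<Sum>i\<in>N7. p m i * f i) * (\<Sum>i\<in>N7. p n i * g i)"
  proof -
    have "(\<Prod>k\<in>{0..m + n}. \<Sum>i\<in>N7. p k i * h k i) = (\<Prod>k\<in>{0..m + n}.
        if k = m then \<Sum>i\<in>N7. p m i * f i else if k = n then \<Sum>i\<in>N7. p n i * g i else 1)"
      by (intro prod.cong) (simp_all add: h_def p_sum)
    then show ?thesis
      by (simp only: prod_two)
  qed
  ultimately have "has_bochner_integral P (\<lambda>\<omega>. f (\<omega> m) * g (\<omega> n))
      ((\<Sum>i\<in>N7. p m i * f i) * (\<Sum>i\<in>N7. p n i * g i))"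
    using has_expectation_prod_coords[of h "m + n"] by simp
  then show ?thesis
    using has_expectation_coord[of f m] has_expectation_coord[of g n]
    by (simp add: has_bochner_integral_integral_eq)
qed

lemma integrable_coord:
  fixes f :: "nat \<Rightarrow> 'b::{banach, second_countable_topology}"
  shows "integrable P (\<lambda>\<omega>. f (\<omega> n))"
  using has_expectation_coord by (rule integrable.intros)

lemma integrable_coord_mult:
  fixes f g :: "nat \<Rightarrow> real"
  shows "integrable P (\<lambda>\<omega>. f (\<omega> m) * g (\<omega> n))"
proof -
  have "f (\<omega> m) * g (\<omega> n) = (\<Sum>i\<in>N7. indicator (cyl m i) \<omega> *\<^sub>R (f i * g (\<omega> n)))"
    if "\<omega> \<in> space P" for \<omega>
    using coord_eq_sum_indicator[OF that, of "\<lambda>i. f i * g (\<omega> n)" m] .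
  moreover have "integrable P (\<lambda>\<omega>. \<Sum>i\<in>N7. indicator (cyl m i) \<omega> *\<^sub>R (f i * g (\<omega> n)))"
    by (intro Bochner_Integration.integrable_sum integrable_mult_indicator cyl_sets integrable_coord)
  ultimately show ?thesis
    by (simp only: cong: Bochner_Integration.integrable_cong)
qed

section \<open>Mean and trace of the walk\<close>

text \<open>
  Written this way, the mean step visibly depends on \<open>p n\<close> only through the quantities that
  Axiom 1* preserves.
\<close>

lemma expectation_S:
  "expectation (S \<epsilon> n) =
    (\<Sum>i\<in>{1,2,3}. (p n i - p n (i + 3)) *\<^sub>R (\<epsilon> *\<^sub>R axis (of_nat i) 1))"
proof -
  have "expectation (S \<epsilon> n) = (\<Sum>i\<in>N7. p n i *\<^sub>R step \<epsilon> i)"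
    using has_expectation_coord[of "step \<epsilon>" n]
    by (simp add: has_bochner_integral_integral_eq S_def[abs_def])
  then show ?thesis
    by (simp add: N7_eq step_def algebra_simps)
qed

lemma expectation_S_const:
  assumes "axiom_1_star p Z" "zero_force_upto Z N" "n \<le> N"
  shows "expectation (S \<epsilon> n) = expectation (S \<epsilon> 0)"
  using \<open>n \<le> N\<close>
proof (induction n)
  case (Suc n)
  then have "Z n"
    using assms(2) by (simp add: zero_force_upto_def)
  then have "expectation (S \<epsilon> (Suc n)) = expectation (S \<epsilon> n)"
    using assms(1) unfolding expectation_S axiom_1_star_def by (intro sum.cong) auto
  with Suc show ?case by simp
qed simp

lemma expectation_R: "expectation (R \<epsilon> n) = (\<Sum>k<n. expectation (S \<epsilon> k))"
  unfolding R_def[abs_def] S_def[abs_def] by (simp add: integrable_coord)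

lemma Tr_R: "Tr P (R \<epsilon> n) = (\<Sum>k<n. Tr P (S \<epsilon> k))"
proof -
  have "variance (\<lambda>\<omega>. R \<epsilon> n \<omega> $ j) = (\<Sum>k<n. variance (\<lambda>\<omega>. S \<epsilon> k \<omega> $ j))" for j
    unfolding R_def S_def sum_component
    by (intro variance_sum_uncorrelated integrable_coord integrable_coord_mult
        uncorrelated_coords[where f = "\<lambda>i. step \<epsilon> i $ j" and g = "\<lambda>i. step \<epsilon> i $ j"]) auto
  then show ?thesis
    unfolding Tr_def by (simp add: sum.swap[of _ UNIV])
qed

text \<open>
  A variance is at most the second moment, and the second moments of the three components sum to
  the mean squared length of the step. Bounding the components together in this way avoids a
  factor of \<open>3\<close>.
\<close>

lemma Tr_S_le: "Tr P (S \<epsilon> n) \<le> \<epsilon>\<^sup>2"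
proof -
  have int2: "integrable P (\<lambda>\<omega>. (step \<epsilon> (\<omega> n) $ j)\<^sup>2)" for j
    by (rule integrable_coord)
  have "Tr P (S \<epsilon> n) \<le> (\<Sum>j\<in>UNIV. expectation (\<lambda>\<omega>. (step \<epsilon> (\<omega> n) $ j)\<^sup>2))"
    unfolding Tr_def S_def
    by (intro sum_mono) (subst variance_eq, auto intro: integrable_coord int2)
  also have "\<dots> = expectation (\<lambda>\<omega>. (norm (step \<epsilon> (\<omega> n)))\<^sup>2)"
    by (simp add: int2 power2_norm_eq_inner inner_vec_def flip: power2_eq_square)
  also have "\<dots> \<le> expectation (\<lambda>\<omega>. \<epsilon>\<^sup>2)"
  proof (intro integral_mono integrable_coord)
    show "(norm (step \<epsilon> (\<omega> n)))\<^sup>2 \<le> \<epsilon>\<^sup>2" for \<omega>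
      using power_mono[OF norm_step_le norm_ge_zero, of \<epsilon> "\<omega> n" 2] by simp
  qed
  finally show ?thesis
    by (simp add: prob_space)
qed

lemma Tr_R_le: "Tr P (R \<epsilon> n) \<le> real n * \<epsilon>\<^sup>2"
  using sum_mono[of "{..<n}" "\<lambda>k. Tr P (S \<epsilon> k)" "\<lambda>_. \<epsilon>\<^sup>2"] by (simp add: Tr_R Tr_S_le)

lemma Tr_nonneg: "0 \<le> Tr P X"
  unfolding Tr_def by (intro sum_nonneg variance_positive)

end

section \<open>Uniform motion and vanishing spread\<close>

theorem theorem4p1:
  fixes c :: real
  assumes "c > 0"
  shows
    "(\<forall>(\<tau>::real) P p Z N.
        \<tau> > 0 \<longrightarrow> walk_space P p \<longrightarrow> axiom_1_star p Z \<longrightarrow> zero_force_upto Z N \<longrightarrow>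
        (\<exists>v. (\<forall>n\<le>N. velocity P c \<tau> n = v) \<and>
             (\<forall>n\<le>N. prob_space.expectation P (R (c * \<tau>) n) = (real n * \<tau>) *\<^sub>R v)))
     \<and>
     (\<forall>(C::real) P p Z.
        C > 0 \<longrightarrow>
        (\<forall>N\<ge>1. walk_space (P N) (p N) \<and> axiom_1_star (p N) (Z N) \<and> zero_force_upto (Z N) N) \<longrightarrow>
        (\<lambda>N. Tr (P N) (R (c * (C / real N)) N)) \<longlonglongrightarrow> 0)"
proof (intro conjI allI impI)
  fix \<tau> :: real and P p Z N
  assume "\<tau> > 0" and walk: "walk_space P p"
    and force: "axiom_1_star p Z" "zero_force_upto Z N"
  interpret walk_space P p by (rule walk)
  have "velocity P c \<tau> n = velocity P c \<tau> 0" if "n \<le> N" for n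
    using expectation_S_const[OF force that] by (simp add: velocity_def)
  moreover have "expectation (R (c * \<tau>) n) = (real n * \<tau>) *\<^sub>R velocity P c \<tau> 0" if "n \<le> N" for n
  proof -
    have "expectation (R (c * \<tau>) n) = (\<Sum>k<n. expectation (S (c * \<tau>) 0))"
      unfolding expectation_R
      by (intro sum.cong refl expectation_S_const[OF force]) (use that in simp)
    then show ?thesis
      using \<open>\<tau> > 0\<close> by (simp only: sum_constant_scaleR velocity_def scaleR_scaleR card_lessThan) simp
  qed
  ultimately show "\<exists>v. (\<forall>n\<le>N. velocity P c \<tau> n = v) \<and>
      (\<forall>n\<le>N. expectation (R (c * \<tau>) n) = (real n * \<tau>) *\<^sub>R v)"
    by blast
next
  fix C :: real and P p Z
  assume walks: "\<forall>N\<ge>1. walk_space (P N) (p N) \<and> axiom_1_star (p N) (Z N) \<and> zero_force_upto (Z N) N"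
  have bounds: "0 \<le> Tr (P N) (R (c * (C / real N)) N)
      \<and> Tr (P N) (R (c * (C / real N)) N) \<le> (c * C)\<^sup>2 / real N" if "N \<ge> 1" for N
  proof -
    interpret walk_space "P N" "p N" using walks that by blast
    have "real N * (c * (C / real N))\<^sup>2 = (c * C)\<^sup>2 / real N"
      using that by (simp add: power2_eq_square field_simps)
    then show ?thesis
      using Tr_R_le[of "c * (C / real N)" N] Tr_nonneg by simp
  qed
  show "(\<lambda>N. Tr (P N) (R (c * (C / real N)) N)) \<longlonglongrightarrow> 0"
  proof (rule tendsto_sandwich)
    show "\<forall>\<^sub>F N in sequentially. 0 \<le> Tr (P N) (R (c * (C / real N)) N)"
      "\<forall>\<^sub>F N in sequentially. Tr (P N) (R (c * (C / real N)) N) \<le> (c * C)\<^sup>2 / real N"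
      using bounds by (auto intro: eventually_sequentiallyI[of 1])
    show "(\<lambda>N. (c * C)\<^sup>2 / real N) \<longlonglongrightarrow> 0"
      by (rule lim_const_over_n)
  qed simp
qed

end
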